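(* Let $k$ be a field of characteristic $0$ and let $(A,+,\cdot,\Sigma)$ be a summability algebra over $k$ with evaluations, with maximal ideal $\mathfrak{m}$. Then $\exp\colon\mathfrak{m}\to1+\mathfrak{m}$ and $\log\colon1+\mathfrak{m}\to\mathfrak{m}$ are bijective, and are functional inverses of one another.
   Context: Vector spaces and algebras are over $k$; algebras are associative, not necessarily commutative. $V^I$ is the space of maps $I\to V$, $V^{(I)}$ the subspace of maps with finite support. Summability spaces. A summability structure $\Sigma$ on a vector space $V$ consists, for every set $I$, of a linear subspace $\mathrm{dom}\,\Sigma_I\subseteq V^I$ (the summable families) and a linear map $\Sigma_I\colon \mathrm{dom}\,\Sigma_I\to V$ (also written $\sum_{i\in I}\mathbf{v}(i)$), such that for all sets $I,J$: (SS1) $V^{(I)}\subseteq \mathrm{dom}\,\Sigma_I$ and $\Sigma_I\mathbf{v}$ is the usual finite sum for $\mathbf{v}\in V^{(I)}$; (SS2) if $\varphi\colon I\to J$ is bijective and $\mathbf{v}\in\mathrm{dom}\,\Sigma_J$, then $\mathbf{v}\circ\varphi\in\mathrm{dom}\,\Sigma_I$ and $\Sigma_I(\mathbf{v}\circ\varphi)=\Sigma_J\mathbf{v}$; (SS3) if $I=\bigsqcup_{j\in J}I_j$ and $\mathbf{v}\in\mathrm{dom}\,\Sigma_I$, then $\mathbf{v}|_{I_j}\in\mathrm{dom}\,\Sigma_{I_j}$ for all $j$, $(\Sigma_{I_j}\mathbf{v}|_{I_j})_{j\in J}\in\mathrm{dom}\,\Sigma_J$ and $\Sigma_I\mathbf{v}=\Sigma_J\big((\Sigma_{I_j}\mathbf{v}|_{I_j})_{j\in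 J}\big)$; (SS4) if $I=I_1\sqcup I_2$, $\mathbf{v}\in\mathrm{dom}\,\Sigma_{I_1}$, $\mathbf{w}\in\mathrm{dom}\,\Sigma_{I_2}$, then the family on $I$ restricting to $\mathbf{v}$ on $I_1$ and to $\mathbf{w}$ on $I_2$ lies in $\mathrm{dom}\,\Sigma_I$. $(V,\Sigma)$ is ultrafinite if moreover (UF): for every $\mathbf{v}\in\mathrm{dom}\,\Sigma_I$ and every family $(f_i\colon X_i\to k)_{i\in I}$ with each $X_i$ finite, the family $(f_i(x)\mathbf{v}(i))_{i\in I,\,x\in X_i}$ is summable. A subspace $W$ is closed if sums of summable families of elements of $W$ lie in $W$. A closed ideal is a two-sided ideal that is a closed subspace. A summability algebra is an algebra $A$ with a summability structure such that for $\mathbf{a}\in\mathrm{dom}\,\Sigma_I$, $\mathbf{b}\in\mathrm{dom}\,\Sigma_J$ the family $(\mathbf{a}(i)\cdot\mathbf{b}(j))_{(i,j)\in I\times J}$ is summable with sum $(\Sigma_I\mathbf{a})\cdot(\Sigma_J\mathbf{b})$. Evaluations. $J^\star=\bigcup_{n\in\mathbb{N}}J^n$ is the set of finite words over $J$ (including the empty word). A unital ultrafinite summability algebra $A$ has evaluations if there is a closed ideal $\mathfrak{m}$ of $A$ with $A=k1_A+\mathfrak{m}$ such that for every set $J$ and every summable family $\mathbf{f}\colon J\to\mathfrak{m}$, the family $(\mathbf{f}(\theta_1)\cdots\mathbf{f}(\theta_n))_{(\theta_1,\dots,\theta_n)\in J^\star}$ is summable in $A$ (empty product $=1_A$). This $\mathfrak{m}$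 is the maximal ideal referred to in the claim. For $\delta\in\mathfrak{m}$ define $\exp(\delta)=\sum_{n\ge0}\frac{1}{n!}\delta^n$, and for $\varepsilon\in\mathfrak{m}$ define $\log(1+\varepsilon)=\sum_{n\ge1}\frac{(-1)^{n+1}}{n}\varepsilon^n$; these families are summable in $A$ because $A$ has evaluations and is ultrafinite. *)

theory Defs
  imports "HOL-Library.Infinite_Typeclass" "HOL-Library.Disjoint_Sets"
begin

text \<open>
  A summability structure assigns summable families and sums to \<^emph>\<open>all\<close> index sets. HOL has no type
  of all sets, so the structure is given on the subsets \<open>I\<close> of an arbitrary infinite type \<open>'i\<close>.
  A family \<open>I \<rightarrow> V\<close> is represented by a total function of which only the values on \<open>I\<close> matter
  (axiom \<open>Dom_cong\<close> below): \<open>Dom I\<close> are the summable families on \<open>I\<close>, \<open>Sig I\<close> is the summation map.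

  For index sets of other types (\<open>I \<times> J\<close>, disjoint unions, words over \<open>J\<close>, the natural numbers) one
  transports along an injection into \<open>'i\<close>. As \<open>'i\<close> is infinite such an injection exists in all these cases, and by
  invariance under bijections the choice is immaterial; see \<open>summable_family_iff\<close> and
  \<open>family_sum_eq\<close>.
\<close>

definition summable_family ::
  "('i set \<Rightarrow> ('i \<Rightarrow> 'v) set) \<Rightarrow> 'j set \<Rightarrow> ('j \<Rightarrow> 'v) \<Rightarrow> bool" where
  "summable_family Dom I v \<longleftrightarrow> (\<exists>\<phi>. inj_on \<phi> I \<and> v \<circ> inv_into I \<phi> \<in> Dom (\<phi> ` I))"

definition family_sum ::
  "('i set \<Rightarrow> ('i \<Rightarrow> 'v) \<Rightarrow> 'v) \<Rightarrow> 'j set \<Rightarrow> ('j \<Rightarrow> 'v) \<Rightarrow> 'v" where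
  "family_sum Sig I v =
     (let \<phi> = (SOME \<phi>. inj_on \<phi> I) in Sig (\<phi> ` I) (v \<circ> inv_into I \<phi>))"

locale summability_space = vector_space scale
  for scale :: "'k::field \<Rightarrow> 'v::ab_group_add \<Rightarrow> 'v" (infixr "*s" 75) +
  fixes Dom :: "'i::infinite set \<Rightarrow> ('i \<Rightarrow> 'v) set"
    and Sig :: "'i set \<Rightarrow> ('i \<Rightarrow> 'v) \<Rightarrow> 'v"
  assumes Dom_cong: "\<lbrakk>v \<in> Dom I; \<And>i. i \<in> I \<Longrightarrow> w i = v i\<rbrakk> \<Longrightarrow> w \<in> Dom I"
    and Sum_cong: "\<lbrakk>v \<in> Dom I; \<And>i. i \<in> I \<Longrightarrow> w i = v i\<rbrakk> \<Longrightarrow> Sig I w = Sig I v"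
    and Dom_add: "\<lbrakk>v \<in> Dom I; w \<in> Dom I\<rbrakk> \<Longrightarrow> (\<lambda>i. v i + w i) \<in> Dom I"
    and Sum_add: "\<lbrakk>v \<in> Dom I; w \<in> Dom I\<rbrakk> \<Longrightarrow> Sig I (\<lambda>i. v i + w i) = Sig I v + Sig I w"
    and Dom_scale: "v \<in> Dom I \<Longrightarrow> (\<lambda>i. c *s v i) \<in> Dom I"
    and Sum_scale: "v \<in> Dom I \<Longrightarrow> Sig I (\<lambda>i. c *s v i) = c *s Sig I v"
    and SS1_Dom: "finite {i \<in> I. v i \<noteq> 0} \<Longrightarrow> v \<in> Dom I"
    and SS1_Sum: "finite {i \<in> I. v i \<noteq> 0} \<Longrightarrow> Sig I v = (\<Sum>i \<in> {i \<in> I. v i \<noteq> 0}. v i)"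
    and SS2_Dom: "\<lbrakk>bij_betw \<phi> I J; v \<in> Dom J\<rbrakk> \<Longrightarrow> v \<circ> \<phi> \<in> Dom I"
    and SS2_Sum: "\<lbrakk>bij_betw \<phi> I J; v \<in> Dom J\<rbrakk> \<Longrightarrow> Sig I (v \<circ> \<phi>) = Sig J v"
    and SS3_part: "\<lbrakk>disjoint_family_on P J; v \<in> Dom (\<Union>j\<in>J. P j); j \<in> J\<rbrakk> \<Longrightarrow> v \<in> Dom (P j)"
    and SS3_Dom: "\<lbrakk>disjoint_family_on P J; v \<in> Dom (\<Union>j\<in>J. P j)\<rbrakk>
                    \<Longrightarrow> (\<lambda>j. Sig (P j) v) \<in> Dom J"
    and SS3_Sum: "\<lbrakk>disjoint_family_on P J; v \<in> Dom (\<Union>j\<in>J. P j)\<rbrakk>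
                    \<Longrightarrow> Sig (\<Union>j\<in>J. P j) v = Sig J (\<lambda>j. Sig (P j) v)"
    and SS4: "\<lbrakk>I\<^sub>1 \<inter> I\<^sub>2 = {}; v \<in> Dom I\<^sub>1; w \<in> Dom I\<^sub>2\<rbrakk>
                    \<Longrightarrow> (\<lambda>i. if i \<in> I\<^sub>1 then v i else w i) \<in> Dom (I\<^sub>1 \<union> I\<^sub>2)"
begin

lemma Dom_transfer:
  fixes \<phi> \<psi> :: "'j \<Rightarrow> 'i"
  assumes "inj_on \<phi> I" "inj_on \<psi> I" "v \<circ> inv_into I \<psi> \<in> Dom (\<psi> ` I)"
  shows "v \<circ> inv_into I \<phi> \<in> Dom (\<phi> ` I)"
    and "Sig (\<phi> ` I) (v \<circ> inv_into I \<phi>) = Sig (\<psi> ` I) (v \<circ> inv_into I \<psi>)"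
proof -
  let ?h = "\<psi> \<circ> inv_into I \<phi>"
  have h: "bij_betw ?h (\<phi> ` I) (\<psi> ` I)"
    by (meson assms(1,2) bij_betw_imageI bij_betw_inv_into bij_betw_trans)
  have eq: "(v \<circ> inv_into I \<phi>) i = (v \<circ> inv_into I \<psi> \<circ> ?h) i" if "i \<in> \<phi> ` I" for i
    using that assms(1,2) by (auto simp: inv_into_f_f)
  note D = SS2_Dom[OF h assms(3)] and S = SS2_Sum[OF h assms(3)]
  show "v \<circ> inv_into I \<phi> \<in> Dom (\<phi> ` I)"
    by (rule Dom_cong[OF D eq])
  show "Sig (\<phi> ` I) (v \<circ> inv_into I \<phi>) = Sig (\<psi> ` I) (v \<circ> inv_into I \<psi>)"
    by (rule trans[OF Sum_cong[OF D eq] S])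
qed

lemma summable_family_iff:
  fixes \<phi> :: "'j \<Rightarrow> 'i"
  assumes "inj_on \<phi> I"
  shows "summable_family Dom I v \<longleftrightarrow> v \<circ> inv_into I \<phi> \<in> Dom (\<phi> ` I)"
  unfolding summable_family_def using assms Dom_transfer(1) by blast

lemma family_sum_eq:
  fixes \<phi> :: "'j \<Rightarrow> 'i"
  assumes "inj_on \<phi> I" "summable_family Dom I v"
  shows "family_sum Sig I v = Sig (\<phi> ` I) (v \<circ> inv_into I \<phi>)"
proof -
  define \<psi> :: "'j \<Rightarrow> 'i" where "\<psi> = (SOME \<psi>. inj_on \<psi> I)"
  have "inj_on \<psi> I"
    unfolding \<psi>_def by (rule someI[of "\<lambda>\<psi>. inj_on \<psi> I", OF assms(1)])
  then show ?thesis
    using Dom_transfer(2)[OF _ assms(1)] assms summable_family_iff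
    unfolding family_sum_def Let_def \<psi>_def[symmetric] by blast
qed

lemma summable_family_index [simp]:
  fixes I :: "'i set"
  shows "summable_family Dom I v \<longleftrightarrow> v \<in> Dom I"
proof -
  have "i \<in> I \<Longrightarrow> inv_into I (\<lambda>x. x) i = i" for i
    using inv_into_f_f[of "\<lambda>x. x" I i] by simp
  then show ?thesis
    using summable_family_iff[of "\<lambda>x. x" I v]
      Dom_cong[of v I "v \<circ> inv_into I (\<lambda>x. x)"] Dom_cong[of "v \<circ> inv_into I (\<lambda>x. x)" I v]
    by auto
qed

lemma family_sum_index:
  fixes I :: "'i set"
  assumes "v \<in> Dom I"
  shows "family_sum Sig I v = Sig I v"
proof -
  have "i \<in> I \<Longrightarrow> inv_into I (\<lambda>x. x) i = i" for i
    using inv_into_f_f[of "\<lambda>x. x" I i] by simp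
  then show ?thesis
    using family_sum_eq[of "\<lambda>x. x" I v] assms
      Sum_cong[of v I "v \<circ> inv_into I (\<lambda>x. x)"]
    by simp
qed

definition closed_subspace :: "'v set \<Rightarrow> bool" where
  "closed_subspace W \<longleftrightarrow>
     subspace W \<and> (\<forall>I. \<forall>v \<in> Dom I. v ` I \<subseteq> W \<longrightarrow> Sig I v \<in> W)"

end

locale ultrafinite_summability_space = summability_space scale Dom Sig
  for scale :: "'k::field \<Rightarrow> 'v::ab_group_add \<Rightarrow> 'v" (infixr "*s" 75)
    and Dom :: "'i::infinite set \<Rightarrow> ('i \<Rightarrow> 'v) set"
    and Sig :: "'i set \<Rightarrow> ('i \<Rightarrow> 'v) \<Rightarrow> 'v" +
  assumes UF: "\<And>v I (X :: 'i \<Rightarrow> 'i set) (f :: 'i \<Rightarrow> 'i \<Rightarrow> 'k). \<lbrakk>v \<in> Dom I; \<And>i. i \<in> I \<Longrightarrow> finite (X i)\<rbrakk>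
    \<Longrightarrow> summable_family Dom (SIGMA i:I. X i) (\<lambda>(i, x). f i x *s v i)"

locale summability_algebra = summability_space scale Dom Sig
  for scale :: "'k::field \<Rightarrow> 'a::ring \<Rightarrow> 'a" (infixr "*s" 75)
    and Dom :: "'i::infinite set \<Rightarrow> ('i \<Rightarrow> 'a) set"
    and Sig :: "'i set \<Rightarrow> ('i \<Rightarrow> 'a) \<Rightarrow> 'a" +
  assumes scale_mult_left: "(c *s a) * b = c *s (a * b)"
    and scale_mult_right: "a * (c *s b) = c *s (a * b)"
    and Dom_mult: "\<lbrakk>v \<in> Dom I; w \<in> Dom J\<rbrakk>
      \<Longrightarrow> summable_family Dom (I \<times> J) (\<lambda>(i, j). v i * w j)"
    and Sum_mult: "\<lbrakk>v \<in> Dom I; w \<in> Dom J\<rbrakk>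
      \<Longrightarrow> family_sum Sig (I \<times> J) (\<lambda>(i, j). v i * w j) = Sig I v * Sig J w"
begin

definition closed_ideal :: "'a set \<Rightarrow> bool" where
  "closed_ideal W \<longleftrightarrow>
     closed_subspace W \<and> (\<forall>a. \<forall>x \<in> W. a * x \<in> W \<and> x * a \<in> W)"

end

text \<open>
  The sort \<open>{ring, monoid_mult}\<close> is that of unital rings in which \<open>0 = 1\<close> is not excluded, unlike
  \<open>ring_1\<close>.
\<close>

locale algebra_with_evaluations =
  summability_algebra scale Dom Sig + ultrafinite_summability_space scale Dom Sig
  for scale :: "'k::field \<Rightarrow> 'a::{ring, monoid_mult} \<Rightarrow> 'a" (infixr "*s" 75)
    and Dom :: "'i::infinite set \<Rightarrow> ('i \<Rightarrow> 'a) set"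
    and Sig :: "'i set \<Rightarrow> ('i \<Rightarrow> 'a) \<Rightarrow> 'a" +
  fixes \<mm> :: "'a set"
  assumes closed_ideal_max: "closed_ideal \<mm>"
    and UNIV_eq_scalars_plus_max: "UNIV = {c *s 1 + x | c x. x \<in> \<mm>}"
    and words_summable: "\<lbrakk>f \<in> Dom J; f ` J \<subseteq> \<mm>\<rbrakk>
      \<Longrightarrow> summable_family Dom (lists J) (\<lambda>\<theta>. prod_list (map f \<theta>))"

definition summability_exp ::
  "('k::field_char_0 \<Rightarrow> 'a::{ring, monoid_mult} \<Rightarrow> 'a) \<Rightarrow> ('i set \<Rightarrow> ('i \<Rightarrow> 'a) \<Rightarrow> 'a) \<Rightarrow> 'a \<Rightarrow> 'a"
  where "summability_exp scale Sig \<delta> =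
    family_sum Sig UNIV (\<lambda>n::nat. scale (1 / fact n) (\<delta> ^ n))"

text \<open>The argument \<open>a\<close> of the logarithm is \<open>1 + \<epsilon>\<close>.\<close>

definition summability_log ::
  "('k::field_char_0 \<Rightarrow> 'a::{ring, monoid_mult} \<Rightarrow> 'a) \<Rightarrow> ('i set \<Rightarrow> ('i \<Rightarrow> 'a) \<Rightarrow> 'a) \<Rightarrow> 'a \<Rightarrow> 'a"
  where "summability_log scale Sig a =
    family_sum Sig {1..} (\<lambda>n::nat. scale ((- 1) ^ (n + 1) / of_nat n) ((a - 1) ^ n))"

end

theory Submission
  imports Defs "HOL-Computational_Algebra.Formal_Power_Series" "HOL-Library.Countable"
begin

text \<open>
  A power series \<open>p\<close> over the base field can be evaluated at every \<open>x\<close> of the maximal ideal: the powers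
  of \<open>x\<close> are the words over a one-element alphabet, so they are summable, and ultrafiniteness allows
  them to be multiplied by the coefficients of \<open>p\<close>. The exponential of \<open>x\<close> is \<open>1\<close> plus the value at \<open>x\<close>
  of \<open>E = fps_exp 1 - 1\<close>, and the logarithm of \<open>1 + x\<close> is the value of \<open>L = fps_ln 1\<close>. As formal power
  series \<open>E\<close> and \<open>L\<close> are inverse to each other under composition. Hence everything follows once
  evaluation is known to turn composition of series into composition of maps, which is
  \<open>fps_eval_compose\<close>: if \<open>q\<close> has no constant term, then \<open>(p oo q)(x) = p(q(x))\<close>.

  For this, consider the letters \<open>q\<^sub>n x\<^sup>n\<close>, for \<open>n\<close> a natural number. The products along all words
  \<open>(n\<^sub>1, \<dots>, n\<^sub>r)\<close>, each multiplied by \<open>p\<^sub>r\<close>, form a summable family, because the algebra has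
  evaluations. Its sum can be computed in two ways. The words of a fixed length \<open>r\<close> contribute \<open>p\<^sub>r\<close>
  times the \<open>r\<close>-th power of \<open>q(x)\<close> (\<open>has_family_sum_words_of_length\<close>), which gives \<open>p(q(x))\<close>. The words
  with a fixed total \<open>n\<close> of their letters contribute the \<open>n\<close>-th coefficient of \<open>p oo q\<close> times \<open>x\<^sup>n\<close>
  (\<open>fps_compose_nth_words\<close>), which gives \<open>(p oo q)(x)\<close>; since \<open>q\<^sub>0 = 0\<close>, only the finitely many words
  without the letter \<open>0\<close> matter here.
\<close>

unbundle fps_syntax

section \<open>Coefficients of a composition of power series\<close>

text \<open>
  Expanding the powers in \<open>\<Sum>\<^sub>r p\<^sub>r q\<^sup>r\<close> gives one term for each word with letter total \<open>n\<close>. By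
  definition only \<open>r \<le> n\<close> appear in the \<open>n\<close>-th coefficient of a composition, so the sum is finite
  even though the words may contain the letter \<open>0\<close>.
\<close>

lemma fps_compose_nth_words:
  fixes p q :: "'k::comm_ring_1 fps"
  shows "(p oo q) $ n = (\<Sum>\<theta> \<in> (\<Union>r\<le>n. natpermute n r). p $ length \<theta> * prod_list (map (($) q) \<theta>))"
proof -
  have nth: "(q ^ r) $ n = (\<Sum>\<theta> \<in> natpermute n r. prod_list (map (($) q) \<theta>))" for r
  proof (cases r)
    case 0
    have "natpermute n 0 = (if n = 0 then {[]} else {})"
      by (auto simp: natpermute_def)
    then show ?thesis using 0 by simp
  next
    case (Suc m)
    have "(\<Prod>j = 0..m. q $ (\<theta> ! j)) = prod_list (map (($) q) \<theta>)" if "\<theta> \<in> natpermute n (Suc m)" for \<theta>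
      using that by (simp add: natpermute_def prod.list_conv_set_nth atLeastLessThanSuc_atLeastAtMost)
    then show ?thesis
      unfolding Suc fps_power_nth_Suc by simp
  qed
  have "(\<Sum>\<theta> \<in> (\<Union>r\<le>n. natpermute n r). p $ length \<theta> * prod_list (map (($) q) \<theta>))
      = (\<Sum>r\<le>n. \<Sum>\<theta> \<in> natpermute n r. p $ length \<theta> * prod_list (map (($) q) \<theta>))"
    by (rule sum.UNION_disjoint) (auto simp: natpermute_finite, auto simp: natpermute_def)
  also have "\<dots> = (\<Sum>r\<le>n. p $ r * (q ^ r) $ n)"
    unfolding nth sum_distrib_left by (intro sum.cong) (auto simp: natpermute_def)
  finally show ?thesis
    by (simp add: fps_compose_nth atLeast0AtMost)
qed

section \<open>Sums of families over arbitrary index sets\<close>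

lemma ex_inj_countable_infinite: "\<exists>\<phi> :: 'j::countable \<Rightarrow> 'i::infinite. inj \<phi>"
proof -
  obtain e :: "nat \<Rightarrow> 'i" where "inj e"
    using infinite_countable_subset[OF infinite_UNIV] by blast
  then have "inj (e \<circ> to_nat :: 'j \<Rightarrow> 'i)"
    by (simp add: inj_compose)
  then show ?thesis by blast
qed

context summability_space
begin

text \<open>
  The axioms speak of families on subsets of \<open>'i\<close>, whereas words, pairs and natural numbers are
  needed below as indices. Saying summability and the value of the sum in one relation lets each
  axiom be carried over to other index types in a single statement.
\<close>

definition has_family_sum :: "'j set \<Rightarrow> ('j \<Rightarrow> 'v) \<Rightarrow> 'v \<Rightarrow> bool" where
  "has_family_sum I v s \<longleftrightarrow> summable_family Dom I v \<and> family_sum Sig I v = s"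

lemma has_family_sum_iff:
  fixes \<phi> :: "'j \<Rightarrow> 'i"
  assumes "inj_on \<phi> I"
  shows "has_family_sum I v s \<longleftrightarrow>
    v \<circ> inv_into I \<phi> \<in> Dom (\<phi> ` I) \<and> Sig (\<phi> ` I) (v \<circ> inv_into I \<phi>) = s"
  using summable_family_iff[OF assms] family_sum_eq[OF assms]
  unfolding has_family_sum_def by metis

lemma summable_family_imp_sum:
  "summable_family Dom I v \<Longrightarrow> has_family_sum I v (family_sum Sig I v)"
  by (simp add: has_family_sum_def)

lemma has_family_sum_unique: "has_family_sum I v s \<Longrightarrow> has_family_sum I v t \<Longrightarrow> s = t"
  by (simp add: has_family_sum_def)

lemma has_family_sum_obtain_inj:
  assumes "has_family_sum (I :: 'j set) v s"
  obtains \<phi> :: "'j \<Rightarrow> 'i" where "inj_on \<phi> I"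
  using assms unfolding has_family_sum_def summable_family_def by blast

lemma has_family_sum_cong:
  assumes "has_family_sum (I :: 'j set) v s" "\<And>i. i \<in> I \<Longrightarrow> w i = v i"
  shows "has_family_sum I w s"
proof -
  obtain \<phi> :: "'j \<Rightarrow> 'i" where \<phi>: "inj_on \<phi> I"
    using assms(1) by (rule has_family_sum_obtain_inj)
  note v = assms(1)[unfolded has_family_sum_iff[OF \<phi>]]
  have eq: "(w \<circ> inv_into I \<phi>) x = (v \<circ> inv_into I \<phi>) x" if "x \<in> \<phi> ` I" for x
    using that assms(2) by (simp add: inv_into_into)
  show ?thesis
    unfolding has_family_sum_iff[OF \<phi>]
    using v Dom_cong[OF conjunct1[OF v] eq] Sum_cong[OF conjunct1[OF v] eq]
    by (simp add: comp_def)
qed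

lemma has_family_sum_reindex:
  assumes h: "bij_betw h (I :: 'j set) (J :: 'l set)" and v: "has_family_sum J v s"
  shows "has_family_sum I (v \<circ> h) s"
proof -
  obtain \<phi> :: "'l \<Rightarrow> 'i" where \<phi>: "inj_on \<phi> J"
    using v by (rule has_family_sum_obtain_inj)
  have inj: "inj_on (\<phi> \<circ> h) I" and im: "(\<phi> \<circ> h) ` I = \<phi> ` J"
    using h \<phi> by (auto simp: bij_betw_def comp_inj_on image_comp[symmetric])
  have eq: "(v \<circ> h \<circ> inv_into I (\<phi> \<circ> h)) x = (v \<circ> inv_into J \<phi>) x" if x: "x \<in> \<phi> ` J" for x
  proof -
    obtain i where i: "i \<in> I" "x = \<phi> (h i)"
      using x h by (auto simp: bij_betw_def)
    then have "h i \<in> J" using h by (auto simp: bij_betw_def)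
    then show ?thesis
      using i inv_into_f_f[OF inj i(1)] inv_into_f_f[OF \<phi>] by simp
  qed
  note v' = v[unfolded has_family_sum_iff[OF \<phi>]]
  show ?thesis
    unfolding has_family_sum_iff[OF inj] im
    using v' Dom_cong[OF conjunct1[OF v'] eq] Sum_cong[OF conjunct1[OF v'] eq]
    by (simp add: comp_def)
qed

lemma has_family_sum_add:
  assumes v: "has_family_sum (I :: 'j set) v s" and w: "has_family_sum I w t"
  shows "has_family_sum I (\<lambda>i. v i + w i) (s + t)"
proof -
  obtain \<phi> :: "'j \<Rightarrow> 'i" where \<phi>: "inj_on \<phi> I"
    using v by (rule has_family_sum_obtain_inj)
  show ?thesis
    using v w Dom_add Sum_add unfolding has_family_sum_iff[OF \<phi>] comp_def by blast
qed

lemma has_family_sum_scale: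
  assumes v: "has_family_sum (I :: 'j set) v s"
  shows "has_family_sum I (\<lambda>i. c *s v i) (c *s s)"
proof -
  obtain \<phi> :: "'j \<Rightarrow> 'i" where \<phi>: "inj_on \<phi> I"
    using v by (rule has_family_sum_obtain_inj)
  show ?thesis
    using v Dom_scale Sum_scale unfolding has_family_sum_iff[OF \<phi>] comp_def by blast
qed

text \<open>
  Countability of the index type provides the injection into \<open>'i\<close> without which no family on \<open>I\<close>
  is summable, not even the zero family.
\<close>

lemma has_family_sum_finite_support:
  fixes I :: "'j::countable set"
  assumes "finite F" "F \<subseteq> I" "\<And>i. i \<in> I - F \<Longrightarrow> v i = 0"
  shows "has_family_sum I v (sum v F)"
proof -
  obtain \<phi> :: "'j \<Rightarrow> 'i" where "inj \<phi>"
    using ex_inj_countable_infinite by blast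
  then have \<phi>: "inj_on \<phi> I"
    by (rule inj_on_subset) simp
  define S where "S = {i \<in> I. v i \<noteq> 0}"
  have SF: "S \<subseteq> F" using assms(3) by (auto simp: S_def)
  then have "finite S" using assms(1) finite_subset by blast
  have "S \<subseteq> I" by (auto simp: S_def)
  then have inv: "inv_into I \<phi> (\<phi> i) = i" if "i \<in> S" for i
    using that \<phi> by auto
  have supp: "{x \<in> \<phi> ` I. (v \<circ> inv_into I \<phi>) x \<noteq> 0} = \<phi> ` S"
    using \<phi> by (auto simp: S_def)
  have fin: "finite {x \<in> \<phi> ` I. (v \<circ> inv_into I \<phi>) x \<noteq> 0}"
    unfolding supp using \<open>finite S\<close> by simp
  have "Sig (\<phi> ` I) (v \<circ> inv_into I \<phi>) = (\<Sum>x \<in> \<phi> ` S. (v \<circ> inv_into I \<phi>) x)"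
    using SS1_Sum[OF fin] unfolding supp .
  also have "\<dots> = sum v S"
    using inv inj_on_subset[OF \<phi> \<open>S \<subseteq> I\<close>] by (simp add: sum.reindex)
  also have "\<dots> = sum v F"
    using SF assms(1,2) by (intro sum.mono_neutral_left) (auto simp: S_def)
  finally show ?thesis
    unfolding has_family_sum_iff[OF \<phi>] using SS1_Dom[OF fin] by blast
qed

text \<open>
  This is (SS3) for the partition of \<open>I\<close> into the fibres of \<open>g\<close>. The set \<open>K\<close> may be larger than the
  image of \<open>g\<close>, since (SS3) admits empty parts.
\<close>

lemma has_family_sum_group:
  fixes I :: "'j set" and g :: "'j \<Rightarrow> 'l::countable"
  assumes v: "has_family_sum I v s" and g: "g ` I \<subseteq> K"
    and t: "\<And>y. y \<in> K \<Longrightarrow> has_family_sum {i \<in> I. g i = y} v (t y)"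
  shows "has_family_sum K t s"
proof -
  obtain \<phi> :: "'j \<Rightarrow> 'i" where \<phi>: "inj_on \<phi> I"
    using v by (rule has_family_sum_obtain_inj)
  obtain \<psi> :: "'l \<Rightarrow> 'i" where "inj \<psi>"
    using ex_inj_countable_infinite by blast
  then have \<psi>: "inj_on \<psi> K"
    by (rule inj_on_subset) simp
  let ?v = "v \<circ> inv_into I \<phi>"
  define P where "P x = \<phi> ` {i \<in> I. g i = inv_into K \<psi> x}" for x
  have disj: "disjoint_family_on P (\<psi> ` K)"
    unfolding disjoint_family_on_def P_def using \<phi> \<psi> by (fastforce simp: inj_on_def)
  have un: "(\<Union>x\<in>\<psi> ` K. P x) = \<phi> ` I"
    using g \<psi> by (auto simp: P_def)
  have dom: "?v \<in> Dom (\<Union>x\<in>\<psi> ` K. P x)" and s: "Sig (\<Union>x\<in>\<psi> ` K. P x) ?v = s"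
    using v unfolding has_family_sum_iff[OF \<phi>] un by auto
  have part: "?v \<in> Dom (P x)" if "x \<in> \<psi> ` K" for x
    using SS3_part[OF disj dom that] .
  have t': "t y = Sig (P (\<psi> y)) ?v" if y: "y \<in> K" for y
  proof -
    let ?F = "{i \<in> I. g i = y}"
    have P: "P (\<psi> y) = \<phi> ` ?F"
      using \<psi> y by (simp add: P_def)
    have \<phi>F: "inj_on \<phi> ?F"
      using \<phi> by (rule inj_on_subset) auto
    have eq: "(v \<circ> inv_into ?F \<phi>) x = ?v x" if x: "x \<in> \<phi> ` ?F" for x
    proof -
      obtain i where "i \<in> ?F" "x = \<phi> i" using x by blast
      then show ?thesis using inv_into_f_f[OF \<phi>F, of i] inv_into_f_f[OF \<phi>, of i] by simp
    qed
    have dF: "?v \<in> Dom (\<phi> ` ?F)" using part[of "\<psi> y"] y P by auto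
    have "has_family_sum ?F v (Sig (P (\<psi> y)) ?v)"
      unfolding has_family_sum_iff[OF \<phi>F] P
      using Dom_cong[OF dF eq] Sum_cong[OF dF eq] by (simp add: comp_def)
    then show ?thesis
      using t[OF y] by (rule has_family_sum_unique[rotated])
  qed
  have eq: "(t \<circ> inv_into K \<psi>) x = Sig (P x) ?v" if "x \<in> \<psi> ` K" for x
    using that t' \<psi> by auto
  show ?thesis
    unfolding has_family_sum_iff[OF \<psi>]
    using Dom_cong[OF SS3_Dom[OF disj dom] eq] Sum_cong[OF SS3_Dom[OF disj dom] eq]
      SS3_Sum[OF disj dom] s by (simp add: comp_def)
qed

text \<open>
  (SS3) applied to the partition of \<open>I\<close> into \<open>J\<close> and its complement, labelled by any two distinct
  elements of \<open>'i\<close>.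
\<close>

lemma summable_family_subset:
  assumes "summable_family Dom (I :: 'j set) v" "J \<subseteq> I"
  shows "summable_family Dom J v"
proof -
  obtain \<phi> :: "'j \<Rightarrow> 'i" where \<phi>: "inj_on \<phi> I"
    using assms(1) unfolding summable_family_def by blast
  have \<phi>J: "inj_on \<phi> J" using inj_on_subset[OF \<phi> assms(2)] .
  let ?v = "v \<circ> inv_into I \<phi>"
  obtain a b :: 'i where ab: "a \<noteq> b"
    using ex_inj_countable_infinite[where 'j = bool] by (metis inj_eq)
  define P where "P x = (if x = a then \<phi> ` J else \<phi> ` (I - J))" for x
  have disj: "disjoint_family_on P {a, b}"
    unfolding disjoint_family_on_def P_def using \<phi> assms(2) by (auto dest: inj_onD)
  have "(\<Union>x\<in>{a, b}. P x) = \<phi> ` I"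
    using ab assms(2) by (auto simp: P_def)
  then have "?v \<in> Dom (\<Union>x\<in>{a, b}. P x)"
    using assms(1) unfolding summable_family_iff[OF \<phi>] by simp
  from SS3_part[OF disj this, of a] have d: "?v \<in> Dom (\<phi> ` J)"
    by (simp add: P_def)
  have "(v \<circ> inv_into J \<phi>) x = ?v x" if "x \<in> \<phi> ` J" for x
    using that assms(2) inv_into_f_f[OF \<phi>J] inv_into_f_f[OF \<phi>] by auto
  from Dom_cong[OF d this] show ?thesis
    unfolding summable_family_iff[OF \<phi>J] .
qed

text \<open>
  Grouping along the inclusion of \<open>J\<close> in \<open>I\<close>: a fibre has one element or none, and the empty
  fibres contribute the zeros.
\<close>

lemma has_family_sum_extend_zero:
  fixes I :: "'j::countable set"
  assumes v: "has_family_sum J v s" and "J \<subseteq> I" and "\<And>i. i \<in> I - J \<Longrightarrow> v i = 0"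
  shows "has_family_sum I v s"
proof (rule has_family_sum_group[where g = "\<lambda>x. x", OF v])
  fix y assume y: "y \<in> I"
  have "has_family_sum {i \<in> J. i = y} v (sum v {i \<in> J. i = y})"
    by (rule has_family_sum_finite_support) auto
  moreover have "sum v {i \<in> J. i = y} = v y"
  proof (cases "y \<in> J")
    case True
    then have "{i \<in> J. i = y} = {y}" by auto
    then show ?thesis by simp
  next
    case False
    then have "{i \<in> J. i = y} = {}" by auto
    then show ?thesis using assms(3)[of y] y False by simp
  qed
  ultimately show "has_family_sum {i \<in> J. i = y} v (v y)" by simp
qed (use assms(2) in auto)

lemma closed_subspace_sum:
  assumes "closed_subspace W" "has_family_sum (I :: 'j set) v s" "v ` I \<subseteq> W"
  shows "s \<in> W"
proof -
  obtain \<phi> :: "'j \<Rightarrow> 'i" where \<phi>: "inj_on \<phi> I"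
    using assms(2) by (rule has_family_sum_obtain_inj)
  have "(v \<circ> inv_into I \<phi>) ` \<phi> ` I \<subseteq> W"
    using assms(3) \<phi> by auto
  then show ?thesis
    using assms(1,2) unfolding closed_subspace_def has_family_sum_iff[OF \<phi>] by blast
qed

end

text \<open>
  Ultrafiniteness with one-element sets \<open>X\<^sub>i\<close>.
\<close>

lemma (in ultrafinite_summability_space) summable_family_rescale:
  assumes "summable_family Dom (I :: 'j set) v"
  shows "summable_family Dom I (\<lambda>i. c i *s v i)"
proof -
  obtain \<phi> :: "'j \<Rightarrow> 'i" where \<phi>: "inj_on \<phi> I"
    using assms unfolding summable_family_def by blast
  let ?v = "v \<circ> inv_into I \<phi>"
  have "summable_family Dom (SIGMA x:\<phi> ` I. {x}) (\<lambda>(x, y). c (inv_into I \<phi> x) *s ?v x)"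
    using assms UF[of ?v "\<phi> ` I" "\<lambda>x. {x}" "\<lambda>x y. c (inv_into I \<phi> x)"]
    unfolding summable_family_iff[OF \<phi>] by simp
  from summable_family_imp_sum[OF this] obtain s where
    s: "has_family_sum (SIGMA x:\<phi> ` I. {x}) (\<lambda>(x, y). c (inv_into I \<phi> x) *s ?v x) s" ..
  have bij: "bij_betw (\<lambda>i. (\<phi> i, \<phi> i)) I (SIGMA x:\<phi> ` I. {x})"
    using \<phi> by (auto simp: bij_betw_def inj_on_def)
  have "has_family_sum I (\<lambda>i. c i *s v i) s"
    by (rule has_family_sum_cong[OF has_family_sum_reindex[OF bij s]]) (use \<phi> in simp)
  then show ?thesis
    by (simp add: has_family_sum_def)
qed

section \<open>Words and powers\<close>

lemma (in summability_algebra) has_family_sum_mult: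
  assumes v: "has_family_sum (I :: 'j set) v s" and w: "has_family_sum (J :: 'l set) w t"
  shows "has_family_sum (I \<times> J) (\<lambda>(i, j). v i * w j) (s * t)"
proof -
  obtain \<phi> :: "'j \<Rightarrow> 'i" where \<phi>: "inj_on \<phi> I"
    using v by (rule has_family_sum_obtain_inj)
  obtain \<psi> :: "'l \<Rightarrow> 'i" where \<psi>: "inj_on \<psi> J"
    using w by (rule has_family_sum_obtain_inj)
  let ?v = "v \<circ> inv_into I \<phi>" and ?w = "w \<circ> inv_into J \<psi>"
  have "?v \<in> Dom (\<phi> ` I)" "Sig (\<phi> ` I) ?v = s" "?w \<in> Dom (\<psi> ` J)" "Sig (\<psi> ` J) ?w = t"
    using v w unfolding has_family_sum_iff[OF \<phi>] has_family_sum_iff[OF \<psi>] by auto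
  then have st: "has_family_sum (\<phi> ` I \<times> \<psi> ` J) (\<lambda>(x, y). ?v x * ?w y) (s * t)"
    using Dom_mult[of ?v "\<phi> ` I" ?w "\<psi> ` J"] Sum_mult[of ?v "\<phi> ` I" ?w "\<psi> ` J"]
    unfolding has_family_sum_def by simp
  have bij: "bij_betw (map_prod \<phi> \<psi>) (I \<times> J) (\<phi> ` I \<times> \<psi> ` J)"
    using \<phi> \<psi> by (auto simp: bij_betw_def inj_on_def)
  show ?thesis
    by (rule has_family_sum_cong[OF has_family_sum_reindex[OF bij st]]) (use \<phi> \<psi> in auto)
qed

context algebra_with_evaluations
begin

lemma closed_subspace_max: "closed_subspace \<mm>"
  using closed_ideal_max unfolding closed_ideal_def by blast

lemma subspace_max: "subspace \<mm>"
  using closed_subspace_max unfolding closed_subspace_def by blast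

lemma max_mult_right: "x \<in> \<mm> \<Longrightarrow> x * a \<in> \<mm>"
  using closed_ideal_max unfolding closed_ideal_def by blast

lemma max_power: "x \<in> \<mm> \<Longrightarrow> 0 < n \<Longrightarrow> x ^ n \<in> \<mm>"
  by (cases n) (auto intro: max_mult_right)

lemma summable_words:
  assumes "summable_family Dom (J :: 'j set) f" "f ` J \<subseteq> \<mm>"
  shows "summable_family Dom (lists J) (\<lambda>\<theta>. prod_list (map f \<theta>))"
proof -
  obtain \<phi> :: "'j \<Rightarrow> 'i" where \<phi>: "inj_on \<phi> J"
    using assms unfolding summable_family_def by blast
  let ?f = "f \<circ> inv_into J \<phi>"
  have "?f ` \<phi> ` J \<subseteq> \<mm>"
    using assms(2) \<phi> by auto
  then have "summable_family Dom (lists (\<phi> ` J)) (\<lambda>\<theta>. prod_list (map ?f \<theta>))"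
    using assms(1) unfolding summable_family_iff[OF \<phi>] by (intro words_summable)
  from summable_family_imp_sum[OF this] obtain s where
    s: "has_family_sum (lists (\<phi> ` J)) (\<lambda>\<theta>. prod_list (map ?f \<theta>)) s" ..
  have bij: "bij_betw (map \<phi>) (lists J) (lists (\<phi> ` J))"
    using \<phi> by (intro bij_betw_imageI) (auto simp: lists_image inj_on_map_lists)
  have "has_family_sum (lists J) (\<lambda>\<theta>. prod_list (map f \<theta>)) s"
  proof (rule has_family_sum_cong[OF has_family_sum_reindex[OF bij s]])
    fix \<theta> assume "\<theta> \<in> lists J"
    then have "map f \<theta> = map ?f (map \<phi> \<theta>)"
      unfolding map_map by (intro map_cong) (use \<phi> in \<open>auto simp: in_lists_conv_set\<close>)
    then show "prod_list (map f \<theta>) = ((\<lambda>\<theta>. prod_list (map ?f \<theta>)) \<circ> map \<phi>) \<theta>"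
      by (simp only: comp_apply)
  qed
  then show ?thesis
    by (simp add: has_family_sum_def)
qed

text \<open>
  The powers of \<open>x\<close> are the products along the words over an alphabet with a single letter.
\<close>

lemma summable_powers:
  assumes "x \<in> \<mm>"
  shows "summable_family Dom UNIV (\<lambda>n::nat. x ^ n)"
proof -
  have "has_family_sum (UNIV :: unit set) (\<lambda>_. x) (\<Sum>_\<in>(UNIV :: unit set). x)"
    by (rule has_family_sum_finite_support) auto
  then have "summable_family Dom (lists (UNIV :: unit set)) (\<lambda>\<theta>. prod_list (map (\<lambda>_. x) \<theta>))"
    using assms by (intro summable_words) (auto simp: has_family_sum_def)
  from summable_family_imp_sum[OF this] obtain s where
    s: "has_family_sum (lists (UNIV :: unit set)) (\<lambda>\<theta>. prod_list (map (\<lambda>_. x) \<theta>)) s" ..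
  have bij: "bij_betw (\<lambda>n. replicate n ()) UNIV (lists UNIV)"
  proof (rule bij_betwI[where g = length])
    show "replicate (length \<theta>) () = \<theta>" for \<theta>
      by (rule nth_equalityI) auto
  qed auto
  have "has_family_sum UNIV (\<lambda>n::nat. x ^ n) s"
    by (rule has_family_sum_cong[OF has_family_sum_reindex[OF bij s]]) simp
  then show ?thesis
    by (simp add: has_family_sum_def)
qed

text \<open>
  Splitting off the first letter identifies the words of length \<open>r + 1\<close> with pairs of a letter and
  a word of length \<open>r\<close>, so the sum over words is an iterated product of sums.
\<close>

lemma has_family_sum_words_of_length:
  fixes f :: "'j::countable \<Rightarrow> 'a"
  assumes f: "has_family_sum J f s"
  shows "has_family_sum {\<theta> \<in> lists J. length \<theta> = r} (\<lambda>\<theta>. prod_list (map f \<theta>)) (s ^ r)"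
proof (induction r)
  case 0
  have "has_family_sum {\<theta> \<in> lists J. length \<theta> = 0} (\<lambda>\<theta>. prod_list (map f \<theta>))
      (\<Sum>\<theta> \<in> {[]}. prod_list (map f \<theta>))"
    by (rule has_family_sum_finite_support) auto
  then show ?case by simp
next
  case (Suc r)
  have bij: "bij_betw (\<lambda>\<theta>. (hd \<theta>, tl \<theta>)) {\<theta> \<in> lists J. length \<theta> = Suc r}
      (J \<times> {\<theta> \<in> lists J. length \<theta> = r})"
    by (rule bij_betwI[where g = "\<lambda>(x, xs). x # xs"]) (auto simp: length_Suc_conv)
  show ?case
    unfolding power_Suc
    by (rule has_family_sum_cong[OF has_family_sum_reindex[OF bij has_family_sum_mult[OF f Suc]]])
      (auto simp: length_Suc_conv)
qed

section \<open>Evaluation of formal power series\<close>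

definition fps_eval :: "'k fps \<Rightarrow> 'a \<Rightarrow> 'a" where
  "fps_eval p x = family_sum Sig UNIV (\<lambda>n. (p $ n) *s x ^ n)"

lemma has_family_sum_fps_eval:
  "x \<in> \<mm> \<Longrightarrow> has_family_sum UNIV (\<lambda>n. (p $ n) *s x ^ n) (fps_eval p x)"
  unfolding fps_eval_def
  by (intro summable_family_imp_sum summable_family_rescale summable_powers)

lemma fps_eval_add: "x \<in> \<mm> \<Longrightarrow> fps_eval (p + q) x = fps_eval p x + fps_eval q x"
  using has_family_sum_unique[OF has_family_sum_fps_eval[of x "p + q"]]
    has_family_sum_add[OF has_family_sum_fps_eval[of x p] has_family_sum_fps_eval[of x q]]
  by (simp add: scale_left_distrib)

lemma fps_eval_1: "x \<in> \<mm> \<Longrightarrow> fps_eval 1 x = 1"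
  using has_family_sum_unique[OF has_family_sum_fps_eval[of x 1]]
    has_family_sum_finite_support[of "{0}" UNIV "\<lambda>n. ((1 :: 'k fps) $ n) *s x ^ n"]
  by simp

lemma fps_eval_X: "x \<in> \<mm> \<Longrightarrow> fps_eval fps_X x = x"
  using has_family_sum_unique[OF has_family_sum_fps_eval[of x fps_X]]
    has_family_sum_finite_support[of "{1}" UNIV "\<lambda>n. ((fps_X :: 'k fps) $ n) *s x ^ n"]
  by simp

lemma fps_term_in_max: "x \<in> \<mm> \<Longrightarrow> p $ 0 = 0 \<Longrightarrow> (p $ n) *s x ^ n \<in> \<mm>"
  using max_power[of x n] subspace_scale[OF subspace_max] subspace_0[OF subspace_max]
  by (cases n) auto

lemma fps_eval_in_max:
  assumes "x \<in> \<mm>" "p $ 0 = 0"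
  shows "fps_eval p x \<in> \<mm>"
  by (rule closed_subspace_sum[OF closed_subspace_max has_family_sum_fps_eval[OF assms(1)]])
    (use fps_term_in_max[OF assms] in auto)

lemma prod_list_fps_terms:
  "prod_list (map (\<lambda>n. (q $ n) *s x ^ n) \<theta>)
    = prod_list (map (($) q) \<theta>) *s x ^ sum_list \<theta>"
  by (induction \<theta>) (auto simp: scale_mult_left scale_mult_right power_add)

text \<open>
  Both sides sum the same family over all words of natural numbers, on the right grouped by length
  and on the left grouped by letter total.
\<close>

lemma fps_eval_compose:
  assumes x: "x \<in> \<mm>" and q: "q $ 0 = 0"
  shows "fps_eval (p oo q) x = fps_eval p (fps_eval q x)"
proof -
  let ?f = "\<lambda>n. (q $ n) *s x ^ n"
  let ?w = "\<lambda>\<theta>. (p $ length \<theta>) *s prod_list (map ?f \<theta>)"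
  have f: "has_family_sum UNIV ?f (fps_eval q x)"
    by (rule has_family_sum_fps_eval[OF x])
  have "summable_family Dom (lists UNIV) ?w"
    using f fps_term_in_max[OF x q]
    by (intro summable_family_rescale[where v = "\<lambda>\<theta>. prod_list (map ?f \<theta>)"] summable_words)
      (auto simp: has_family_sum_def)
  from summable_family_imp_sum[OF this] obtain s where s: "has_family_sum (lists UNIV) ?w s" ..
  have "has_family_sum UNIV (\<lambda>r. (p $ r) *s fps_eval q x ^ r) s"
  proof (rule has_family_sum_group[where g = length, OF s])
    fix r
    show "has_family_sum {\<theta> \<in> lists UNIV. length \<theta> = r} ?w ((p $ r) *s fps_eval q x ^ r)"
      by (rule has_family_sum_cong[OF has_family_sum_scale[OF has_family_sum_words_of_length[OF f]]])
        simp
  qed simp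
  moreover have "has_family_sum UNIV (\<lambda>n. ((p oo q) $ n) *s x ^ n) s"
  proof (rule has_family_sum_group[where g = sum_list, OF s])
    fix n
    let ?F = "\<Union>r\<le>n. natpermute n r"
    have "has_family_sum {\<theta> \<in> lists UNIV. sum_list \<theta> = n} ?w (sum ?w ?F)"
    proof (rule has_family_sum_finite_support)
      \<comment> \<open>A word longer than its total contains the letter \<open>0\<close>, whose coefficient \<open>q $ 0\<close> vanishes.\<close>
      fix \<theta> assume \<theta>: "\<theta> \<in> {\<theta> \<in> lists UNIV. sum_list \<theta> = n} - ?F"
      have "length \<theta> \<le> sum_list \<theta>" if "0 \<notin> set \<theta>"
        using that by (induction \<theta>) auto
      with \<theta> have "0 \<in> set \<theta>"
        by (auto simp: natpermute_def)
      then have "prod_list (map (($) q) \<theta>) = 0"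
        using q by (auto simp: prod_list_zero_iff image_iff)
      then show "?w \<theta> = 0"
        by (simp add: prod_list_fps_terms)
    qed (auto simp: natpermute_finite, auto simp: natpermute_def)
    moreover have "sum ?w ?F = ((p oo q) $ n) *s x ^ n"
      unfolding fps_compose_nth_words scale_sum_left
      by (intro sum.cong) (auto simp: prod_list_fps_terms natpermute_def)
    ultimately show "has_family_sum {\<theta> \<in> lists UNIV. sum_list \<theta> = n} ?w (((p oo q) $ n) *s x ^ n)"
      by simp
  qed simp
  ultimately show ?thesis
    using has_family_sum_fps_eval[OF x, of "p oo q"]
      has_family_sum_fps_eval[OF fps_eval_in_max[OF x q], of p]
    unfolding has_family_sum_def by metis
qed

end

section \<open>The exponential and the logarithm\<close>

theorem corollary2p5:
  fixes scale :: "'k::field_char_0 \<Rightarrow> 'a::{ring, monoid_mult} \<Rightarrow> 'a"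
    and Dom :: "'i::infinite set \<Rightarrow> ('i \<Rightarrow> 'a) set"
    and Sig :: "'i set \<Rightarrow> ('i \<Rightarrow> 'a) \<Rightarrow> 'a"
    and \<mm> :: "'a set"
  assumes "algebra_with_evaluations scale Dom Sig \<mm>"
  shows "bij_betw (summability_exp scale Sig) \<mm> ((+) 1 ` \<mm>)
    \<and> bij_betw (summability_log scale Sig) ((+) 1 ` \<mm>) \<mm>
    \<and> (\<forall>\<delta> \<in> \<mm>. summability_log scale Sig (summability_exp scale Sig \<delta>) = \<delta>)
    \<and> (\<forall>a \<in> (+) 1 ` \<mm>. summability_exp scale Sig (summability_log scale Sig a) = a)"
proof -
  interpret algebra_with_evaluations scale Dom Sig \<mm> by fact
  define E L :: "'k fps" where "E = fps_exp 1 - 1" and "L = fps_ln 1"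
  have E0: "E $ 0 = 0" and L0: "L $ 0 = 0"
    by (simp_all add: E_def L_def fps_ln_def)
  have L_inv: "L = fps_inv E"
    by (simp add: E_def L_def fps_ln_fps_exp_inv)
  have "E $ 1 \<noteq> 0"
    by (simp add: E_def)
  then have LE: "L oo E = fps_X" and EL: "E oo L = fps_X"
    unfolding L_inv using E0 by (auto intro: fps_inv fps_inv_right)
  have exp_eq: "summability_exp scale Sig x = 1 + fps_eval E x" if x: "x \<in> \<mm>" for x
  proof -
    have "summability_exp scale Sig x = fps_eval (1 + E) x"
      by (simp add: summability_exp_def fps_eval_def E_def)
    then show ?thesis
      using x by (simp add: fps_eval_add fps_eval_1)
  qed
  have log_eq: "summability_log scale Sig (1 + x) = fps_eval L x" if x: "x \<in> \<mm>" for x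
  proof -
    \<comment> \<open>The logarithm is summed over \<open>{1..}\<close> but \<open>fps_eval L\<close> over all exponents; the constant term
      of \<open>L\<close> is zero.\<close>
    let ?l = "\<lambda>n. scale (L $ n) (x ^ n)"
    have "summable_family Dom {1..} ?l"
      using has_family_sum_fps_eval[OF x, of L] unfolding has_family_sum_def
      by (blast intro: summable_family_subset)
    from summable_family_imp_sum[OF this] have l: "has_family_sum {1..} ?l (family_sum Sig {1..} ?l)" .
    have "has_family_sum {1..} (\<lambda>n::nat. scale ((- 1) ^ (n + 1) / of_nat n) (x ^ n))
        (family_sum Sig {1..} ?l)"
    proof (rule has_family_sum_cong[OF l])
      fix n :: nat assume "n \<in> {1..}"
      then obtain m where "n = Suc m" by (cases n) auto
      then show "scale ((- 1) ^ (n + 1) / of_nat n) (x ^ n) = ?l n"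
        by (simp add: L_def fps_ln_nth)
    qed
    then have "summability_log scale Sig (1 + x) = family_sum Sig {1..} ?l"
      by (simp add: summability_log_def has_family_sum_def)
    moreover have "has_family_sum UNIV ?l (family_sum Sig {1..} ?l)"
      by (rule has_family_sum_extend_zero[OF l]) (auto simp: L0 not_le)
    ultimately show ?thesis
      using has_family_sum_fps_eval[OF x, of L] has_family_sum_unique by metis
  qed
  have log_exp: "summability_log scale Sig (summability_exp scale Sig x) = x" if x: "x \<in> \<mm>" for x
    using x E0 by (simp add: exp_eq log_eq fps_eval_in_max fps_eval_compose[symmetric] LE fps_eval_X)
  have exp_log: "summability_exp scale Sig (summability_log scale Sig a) = a"
    if a: "a \<in> (+) 1 ` \<mm>" for a
    using a L0
    by (auto simp: exp_eq log_eq fps_eval_in_max fps_eval_compose[symmetric] EL fps_eval_X)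
  have exp_mem: "summability_exp scale Sig x \<in> (+) 1 ` \<mm>" if "x \<in> \<mm>" for x
    using that E0 by (simp add: exp_eq fps_eval_in_max)
  have log_mem: "summability_log scale Sig a \<in> \<mm>" if "a \<in> (+) 1 ` \<mm>" for a
    using that L0 by (auto simp: log_eq fps_eval_in_max)
  have "bij_betw (summability_exp scale Sig) \<mm> ((+) 1 ` \<mm>)"
    by (rule bij_betw_byWitness[where f' = "summability_log scale Sig"])
      (use exp_mem log_mem log_exp exp_log in blast)+
  moreover have "bij_betw (summability_log scale Sig) ((+) 1 ` \<mm>) \<mm>"
    by (rule bij_betw_byWitness[where f' = "summability_exp scale Sig"])
      (use exp_mem log_mem log_exp exp_log in blast)+
  ultimately show ?thesis
    using log_exp exp_log by blast
qed

end
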